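(* Let $K$ be a locally compact Hausdorff space and let $X$ be a Banach space. If $X^*$ admits a weak-$*$ approximate nearest point map, then the pair $(X,C_0(K))$ has the Bishop-Phelps-Bollobás property for operators.
   Context: Banach spaces are over a fixed scalar field ($\mathbb{R}$ or $\mathbb{C}$). $C_0(K)$ is the space of scalar-valued continuous functions on $K$ vanishing at infinity, with the supremum norm. $S_X$, $B_X$ denote the unit sphere and closed unit ball of $X$; $L(X,Y)$ is the space of bounded linear operators. Let $f:[0,\infty)\to[0,\infty)$ be a nondecreasing function with $\lim_{t\to0+}f(t)=0=f(0)$. A map $\varphi:X^*\to B_{X^*}$ is an $f$-approximate nearest point map if $$\|\varphi(x^* )-x^*\|\le d(x^*,B_{X^*})+f(d(x^*,B_{X^*}))\quad\text{for all }x^*\in X^*,$$ where $d(x^*,B_{X^*})$ is the norm distance from $x^*$ to $B_{X^*}$. $X^*$ admits a weak-$*$ approximate nearest point map if for some such $f$ there is a weak-$*$ continuous (weak-$*$ to weak-$*$) $f$-approximate nearest point map $\varphi:X^*\to B_{X^*}$. A pair $(X,Y)$ of Banach spaces has the Bishop-Phelps-Bollobás property for operators if for every $\varepsilon\in(0,1)$ there is $\eta(\varepsilon)>0$ such that for every $T_0\in L(X,Y)$ with $\|T_0\|=1$ and every $x_0\in S_X$ with $\|T_0(x_0)\|>1-\eta(\varepsilon)$, there exist $S\in L(X,Y)$ and $x\in S_X$ such that $1=\|S\|=\|Sx\|$, $\|x_0-x\|<\varepsilon$ and $\|T_0-S\|<\varepsilon$. *)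

theory Defs
  imports "HOL-Analysis.Analysis"
begin

section \<open>Banach spaces over the reals or the complex numbers\<close>

text \<open>
  A Banach space over a scalar field \<open>'k\<close> is a type of class \<open>banach\<close> (which supplies the
  addition, the norm, completeness and the real scaling) with an explicit scaling by \<open>'k\<close>
  that extends the real one and for which the norm is absolutely homogeneous.  It is used
  only for \<open>'k = real\<close>, where the scaling can only be \<open>scaleR\<close>, and for \<open>'k = complex\<close>.
\<close>

locale banach_over = vector_space scale
  for scale :: "'k::real_normed_field \<Rightarrow> 'x::banach \<Rightarrow> 'x" +
  assumes scale_of_real: "scale (of_real r) x = r *\<^sub>R x"
    and norm_scale: "norm (scale c x) = norm c * norm x"

lemma banach_over_scaleR: "banach_over (scaleR :: real \<Rightarrow> 'x::banach \<Rightarrow> 'x)"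
  by unfold_locales (auto simp: algebra_simps)

lemma banach_over_real_unique:
  fixes scale :: "real \<Rightarrow> 'x::banach \<Rightarrow> 'x"
  assumes "banach_over scale"
  shows "scale = scaleR"
proof (intro ext)
  fix r x
  show "scale r x = r *\<^sub>R x"
    using banach_over.scale_of_real[OF assms, of r x] by simp
qed

text \<open>
  The type \<open>'x \<Rightarrow>\<^sub>L 'y\<close> contains the bounded real-linear maps, with the operator norm;
  \<open>operators sX sY\<close> is the subspace of those linear over \<open>'k\<close>.
\<close>

definition operators ::
  "('k \<Rightarrow> 'x \<Rightarrow> 'x) \<Rightarrow> ('k \<Rightarrow> 'y \<Rightarrow> 'y) \<Rightarrow> ('x::real_normed_vector \<Rightarrow>\<^sub>L 'y::real_normed_vector) set"
  where "operators sX sY =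
    {T. \<forall>c x. blinfun_apply T (sX c x) = sY c (blinfun_apply T x)}"

definition dual :: "('k \<Rightarrow> 'x \<Rightarrow> 'x) \<Rightarrow> ('x::real_normed_vector \<Rightarrow>\<^sub>L 'k::real_normed_field) set"
  where "dual s = operators s (*)"

definition dual_ball :: "('k \<Rightarrow> 'x \<Rightarrow> 'x) \<Rightarrow> ('x::real_normed_vector \<Rightarrow>\<^sub>L 'k::real_normed_field) set"
  where "dual_ball s = dual s \<inter> cball 0 1"

text \<open>
  Here \<open>euclidean\<close> is the topology of pointwise convergence on \<open>'x \<Rightarrow> 'k\<close>, so this is the
  coarsest topology on the dual that makes all point evaluations continuous.
\<close>

definition weak_star ::
  "('k \<Rightarrow> 'x \<Rightarrow> 'x) \<Rightarrow> ('x::real_normed_vector \<Rightarrow>\<^sub>L 'k::real_normed_field) topology"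
  where "weak_star s = pullback_topology (dual s) blinfun_apply euclidean"

lemma topspace_weak_star: "topspace (weak_star s) = dual s"
  by (simp add: weak_star_def topspace_pullback_topology)

section \<open>Approximate nearest point maps\<close>

text \<open>Only the values of \<open>f\<close> on \<open>[0, \<infinity>)\<close> matter, here and below.\<close>

definition nearest_point_modulus :: "(real \<Rightarrow> real) \<Rightarrow> bool"
  where "nearest_point_modulus f \<longleftrightarrow>
    (\<forall>t\<ge>0. 0 \<le> f t) \<and> mono_on {0..} f \<and> f 0 = 0 \<and> (f \<longlongrightarrow> 0) (at_right 0)"

definition approx_nearest_point_map ::
  "('k \<Rightarrow> 'x \<Rightarrow> 'x) \<Rightarrow> (real \<Rightarrow> real) \<Rightarrow>
   (('x::real_normed_vector \<Rightarrow>\<^sub>L 'k::real_normed_field) \<Rightarrow> ('x \<Rightarrow>\<^sub>L 'k)) \<Rightarrow> bool"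
  where "approx_nearest_point_map s f \<phi> \<longleftrightarrow>
    \<phi> \<in> dual s \<rightarrow> dual_ball s \<and>
    (\<forall>u\<in>dual s. norm (\<phi> u - u) \<le> infdist u (dual_ball s) + f (infdist u (dual_ball s)))"

definition admits_weak_star_approx_nearest_point_map ::
  "('k::real_normed_field \<Rightarrow> 'x::real_normed_vector \<Rightarrow> 'x) \<Rightarrow> bool"
  where "admits_weak_star_approx_nearest_point_map s \<longleftrightarrow>
    (\<exists>f \<phi>. nearest_point_modulus f \<and> approx_nearest_point_map s f \<phi> \<and>
      continuous_map (weak_star s) (weak_star s) \<phi>)"

section \<open>The Bishop-Phelps-Bollobas property for operators\<close>

definition BPB_property ::
  "('k::real_normed_field \<Rightarrow> 'x::banach \<Rightarrow> 'x) \<Rightarrow> ('k \<Rightarrow> 'y::banach \<Rightarrow> 'y) \<Rightarrow> bool"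
  where "BPB_property sX sY \<longleftrightarrow>
    (\<forall>\<epsilon>. 0 < \<epsilon> \<and> \<epsilon> < 1 \<longrightarrow>
      (\<exists>\<eta>>0. \<forall>T0\<in>operators sX sY. \<forall>x0\<in>sphere 0 1.
        norm T0 = 1 \<and> norm (blinfun_apply T0 x0) > 1 - \<eta> \<longrightarrow>
        (\<exists>S\<in>operators sX sY. \<exists>x\<in>sphere 0 1.
          norm S = 1 \<and> norm (blinfun_apply S x) = 1 \<and>
          norm (x0 - x) < \<epsilon> \<and> norm (T0 - S) < \<epsilon>)))"

section \<open>Continuous functions vanishing at infinity\<close>

definition vanishes_at_infinity :: "('a::topological_space \<Rightarrow> 'b::real_normed_vector) \<Rightarrow> bool"
  where "vanishes_at_infinity f \<longleftrightarrow> (\<forall>e>0. compact {t. e \<le> norm (f t)})"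

typedef (overloaded) ('a, 'b) c0 =
  "{f :: 'a::topological_space \<Rightarrow> 'b::real_normed_vector.
      continuous_on UNIV f \<and> vanishes_at_infinity f}"
  morphisms c0_apply Abs_c0
  by (rule exI[of _ "\<lambda>_. 0"]) (auto simp: vanishes_at_infinity_def)

setup_lifting type_definition_c0

lemma c0_continuous: "continuous_on UNIV (c0_apply f)"
  and c0_vanishes: "vanishes_at_infinity (c0_apply f)"
  using c0_apply[of f] by auto

lemma c0_eqI: "(\<And>t. c0_apply f t = c0_apply g t) \<Longrightarrow> f = g"
  by (auto simp: c0_apply_inject[symmetric])

lemma vanishes_at_infinity_dominated:
  fixes g :: "'a::topological_space \<Rightarrow> 'b::real_normed_vector"
    and f :: "'a \<Rightarrow> 'c::real_normed_vector"
  assumes g: "continuous_on UNIV g" and f: "vanishes_at_infinity f"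
    and le: "\<And>t. norm (g t) \<le> M * norm (f t)"
  shows "vanishes_at_infinity g"
  unfolding vanishes_at_infinity_def
proof (intro allI impI)
  fix e :: real assume e: "0 < e"
  define N where "N = max M 1"
  have N: "0 < N" "M \<le> N" by (auto simp: N_def)
  have "closed {t. e \<le> norm (g t)}"
    by (intro closed_Collect_le continuous_intros g)
  moreover have "compact {t. e / N \<le> norm (f t)}"
    using f e N by (auto simp: vanishes_at_infinity_def)
  moreover have "{t. e \<le> norm (g t)} \<subseteq> {t. e / N \<le> norm (f t)}"
  proof safe
    fix t assume "e \<le> norm (g t)"
    also have "\<dots> \<le> M * norm (f t)" by (rule le)
    also have "\<dots> \<le> N * norm (f t)" using N by (intro mult_right_mono) auto
    finally show "e / N \<le> norm (f t)" using N by (simp add: field_simps)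
  qed
  ultimately show "compact {t. e \<le> norm (g t)}"
    using compact_Int_closed[of "{t. e / N \<le> norm (f t)}" "{t. e \<le> norm (g t)}"]
    by (simp add: Int_absorb1)
qed

lemma vanishes_at_infinity_add:
  fixes f g :: "'a::topological_space \<Rightarrow> 'b::real_normed_vector"
  assumes "continuous_on UNIV f" "continuous_on UNIV g"
    and "vanishes_at_infinity f" "vanishes_at_infinity g"
  shows "vanishes_at_infinity (\<lambda>t. f t + g t)"
  unfolding vanishes_at_infinity_def
proof (intro allI impI)
  fix e :: real assume e: "0 < e"
  let ?C = "{t. e / 2 \<le> norm (f t)} \<union> {t. e / 2 \<le> norm (g t)}"
  have "closed {t. e \<le> norm (f t + g t)}"
    by (intro closed_Collect_le continuous_intros assms)
  moreover have "compact ?C"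
    using assms(3,4) half_gt_zero[OF e] unfolding vanishes_at_infinity_def
    by (intro compact_Un) blast+
  moreover have "{t. e \<le> norm (f t + g t)} \<subseteq> ?C"
    by safe (smt (verit) field_sum_of_halves norm_triangle_ineq)
  ultimately show "compact {t. e \<le> norm (f t + g t)}"
    using compact_Int_closed[of ?C "{t. e \<le> norm (f t + g t)}"]
    by (simp add: Int_absorb1)
qed

lemma c0_bounded: "bounded (range (c0_apply f))"
proof -
  let ?C = "{t. 1 \<le> norm (c0_apply f t)}"
  have "compact ?C"
    using c0_vanishes[of f] by (auto simp: vanishes_at_infinity_def)
  then have "bounded (c0_apply f ` ?C)"
    by (intro compact_imp_bounded compact_continuous_image)
      (auto intro: continuous_on_subset[OF c0_continuous])
  then obtain B where "\<And>t. t \<in> ?C \<Longrightarrow> norm (c0_apply f t) \<le> B"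
    by (auto simp: bounded_iff)
  then have "norm (c0_apply f t) \<le> max B 1" for t
    by (cases "t \<in> ?C") (auto intro: max.coboundedI1 max.coboundedI2)
  then show ?thesis by (auto simp: bounded_iff)
qed

instantiation c0 :: (topological_space, real_normed_vector) real_vector
begin

lift_definition zero_c0 :: "('a, 'b) c0" is "\<lambda>_. 0"
  by (auto simp: vanishes_at_infinity_def)

lift_definition plus_c0 :: "('a, 'b) c0 \<Rightarrow> ('a, 'b) c0 \<Rightarrow> ('a, 'b) c0" is "\<lambda>f g t. f t + g t"
  by (auto intro: vanishes_at_infinity_add continuous_intros)

lift_definition uminus_c0 :: "('a, 'b) c0 \<Rightarrow> ('a, 'b) c0" is "\<lambda>f t. - f t"
  by (auto simp: vanishes_at_infinity_def intro: continuous_intros)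

definition minus_c0 :: "('a, 'b) c0 \<Rightarrow> ('a, 'b) c0 \<Rightarrow> ('a, 'b) c0"
  where "minus_c0 f g = f + (- g)"

lift_definition scaleR_c0 :: "real \<Rightarrow> ('a, 'b) c0 \<Rightarrow> ('a, 'b) c0" is "\<lambda>r f t. r *\<^sub>R f t"
  by (auto intro!: continuous_intros elim!: vanishes_at_infinity_dominated[rotated])

lemma minus_c0_apply: "c0_apply (f - g) t = c0_apply f t - c0_apply g t"
  by (simp add: minus_c0_def plus_c0.rep_eq uminus_c0.rep_eq)

instance
  by standard
    (auto intro!: c0_eqI simp: minus_c0_apply zero_c0.rep_eq plus_c0.rep_eq uminus_c0.rep_eq
      scaleR_c0.rep_eq algebra_simps)

end

lemmas c0_apply_simps [simp] =
  zero_c0.rep_eq plus_c0.rep_eq uminus_c0.rep_eq minus_c0_apply scaleR_c0.rep_eq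

instantiation c0 :: (topological_space, real_normed_vector) real_normed_vector
begin

definition norm_c0 :: "('a, 'b) c0 \<Rightarrow> real"
  where "norm_c0 f = (SUP t. norm (c0_apply f t))"

definition dist_c0 :: "('a, 'b) c0 \<Rightarrow> ('a, 'b) c0 \<Rightarrow> real"
  where "dist_c0 f g = norm (f - g)"

definition sgn_c0 :: "('a, 'b) c0 \<Rightarrow> ('a, 'b) c0"
  where "sgn_c0 f = f /\<^sub>R norm f"

definition uniformity_c0 :: "(('a, 'b) c0 \<times> ('a, 'b) c0) filter"
  where "uniformity_c0 = (INF e\<in>{0 <..}. principal {(x, y). dist x y < e})"

definition open_c0 :: "('a, 'b) c0 set \<Rightarrow> bool"
  where "open_c0 S = (\<forall>x\<in>S. \<forall>\<^sub>F (x', y) in uniformity. x' = x \<longrightarrow> y \<in> S)"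

lemma norm_c0_upper: "norm (c0_apply f t) \<le> norm f"
  unfolding norm_c0_def
  by (rule cSUP_upper) (use c0_bounded[of f] in \<open>auto simp: bounded_iff bdd_above_def\<close>)

lemma norm_c0_least: "(\<And>t. norm (c0_apply f t) \<le> b) \<Longrightarrow> norm f \<le> b"
  unfolding norm_c0_def by (rule cSUP_least) auto

instance
proof
  fix f g :: "('a, 'b) c0" and a :: real
  show "norm f = 0 \<longleftrightarrow> f = 0"
  proof
    assume "norm f = 0"
    then show "f = 0"
      using norm_c0_upper[of f] by (intro c0_eqI) simp
  next
    assume "f = 0"
    then show "norm f = 0" by (simp add: norm_c0_def)
  qed
  show "norm (f + g) \<le> norm f + norm g"
    by (rule norm_c0_least) (auto intro!: norm_triangle_le add_mono norm_c0_upper)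
  have le: "norm (b *\<^sub>R h) \<le> \<bar>b\<bar> * norm h" for b and h :: "('a, 'b) c0"
    by (rule norm_c0_least) (auto intro!: mult_left_mono norm_c0_upper)
  show "norm (a *\<^sub>R f) = \<bar>a\<bar> * norm f"
  proof (cases "a = 0")
    case False
    have "norm f = norm ((1 / a) *\<^sub>R (a *\<^sub>R f))" using False by simp
    also have "\<dots> \<le> \<bar>1 / a\<bar> * norm (a *\<^sub>R f)" by (rule le)
    finally have "\<bar>a\<bar> * norm f \<le> norm (a *\<^sub>R f)"
      using False by (simp add: field_simps)
    with le[of a f] show ?thesis by simp
  qed (simp add: norm_c0_def)
qed (auto simp: dist_c0_def sgn_c0_def uniformity_c0_def open_c0_def)

end

instance c0 :: (topological_space, banach) banach
proof
  fix F :: "nat \<Rightarrow> ('a, 'b) c0"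
  assume C: "Cauchy F"
  have "uniformly_Cauchy_on UNIV (\<lambda>n. c0_apply (F n))"
    unfolding uniformly_Cauchy_on_def
  proof (intro allI impI)
    fix e :: real assume "0 < e"
    with C obtain M where M: "\<And>m n. m \<ge> M \<Longrightarrow> n \<ge> M \<Longrightarrow> norm (F m - F n) < e"
      unfolding Cauchy_def dist_norm by blast
    have "dist (c0_apply (F m) t) (c0_apply (F n) t) < e" if "m \<ge> M" "n \<ge> M" for m n t
      using norm_c0_upper[of "F m - F n" t] M[OF that] by (simp add: dist_norm)
    then show "\<exists>M. \<forall>t\<in>UNIV. \<forall>m\<ge>M. \<forall>n\<ge>M. dist (c0_apply (F m) t) (c0_apply (F n) t) < e"
      by blast
  qed
  then obtain l where l: "uniform_limit UNIV (\<lambda>n. c0_apply (F n)) l sequentially"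
    using Cauchy_uniformly_convergent unfolding uniformly_convergent_on_def by blast
  have cont: "continuous_on UNIV l"
    by (rule uniform_limit_theorem[OF _ l]) (simp_all add: c0_continuous)
  have "vanishes_at_infinity l"
    unfolding vanishes_at_infinity_def
  proof (intro allI impI)
    fix e :: real assume e: "0 < e"
    then obtain n where n: "\<And>t. dist (c0_apply (F n) t) (l t) < e / 2"
      using l unfolding uniform_limit_sequentially_iff by (meson UNIV_I half_gt_zero order_refl)
    let ?C = "{t. e / 2 \<le> norm (c0_apply (F n) t)}"
    have "closed {t. e \<le> norm (l t)}"
      by (intro closed_Collect_le continuous_intros cont)
    moreover have "compact ?C"
      using c0_vanishes[of "F n"] half_gt_zero[OF e] unfolding vanishes_at_infinity_def by blast
    moreover have "{t. e \<le> norm (l t)} \<subseteq> ?C"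
    proof safe
      fix t assume "e \<le> norm (l t)"
      moreover have "norm (l t) \<le> norm (c0_apply (F n) t) + dist (c0_apply (F n) t) (l t)"
        by (metis dist_norm norm_minus_commute norm_triangle_sub)
      ultimately show "e / 2 \<le> norm (c0_apply (F n) t)" using n[of t] by linarith
    qed
    ultimately show "compact {t. e \<le> norm (l t)}"
      using compact_Int_closed[of ?C "{t. e \<le> norm (l t)}"]
      by (simp add: Int_absorb1)
  qed
  with cont have L: "c0_apply (Abs_c0 l) = l" by (simp add: Abs_c0_inverse)
  have "F \<longlonglongrightarrow> Abs_c0 l"
  proof (rule tendstoI)
    fix e :: real assume e: "0 < e"
    then have "\<forall>\<^sub>F n in sequentially. \<forall>t\<in>UNIV. dist (c0_apply (F n) t) (l t) < e / 2"
      using uniform_limitD[OF l, of "e / 2"] by simp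
    then show "\<forall>\<^sub>F n in sequentially. dist (F n) (Abs_c0 l) < e"
    proof eventually_elim
      case (elim n)
      have "norm (F n - Abs_c0 l) \<le> e / 2"
        by (rule norm_c0_least) (use elim in \<open>auto simp: L dist_norm less_imp_le\<close>)
      with e show ?case by (simp add: dist_norm)
    qed
  qed
  then show "convergent F" by (rule convergentI)
qed

lift_definition c0_scale ::
  "'k \<Rightarrow> ('a::topological_space, 'k::real_normed_field) c0 \<Rightarrow> ('a, 'k) c0"
  is "\<lambda>c f t. c * f t"
  by (auto intro!: continuous_intros elim!: vanishes_at_infinity_dominated[rotated] simp: norm_mult)

lemma banach_over_c0_scale:
  "banach_over (c0_scale :: 'k \<Rightarrow> ('a::topological_space, 'k::{real_normed_field,banach}) c0 \<Rightarrow> _)"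
proof
  fix c :: 'k and f :: "('a, 'k) c0"
  have le: "norm (c0_scale d h) \<le> norm d * norm h" for d :: 'k and h :: "('a, 'k) c0"
    by (rule norm_c0_least) (auto simp: c0_scale.rep_eq norm_mult intro!: mult_left_mono norm_c0_upper)
  show "norm (c0_scale c f) = norm c * norm f"
  proof (cases "c = 0")
    case True
    then show ?thesis using le[of c f] by simp
  next
    case False
    have "f = c0_scale (1 / c) (c0_scale c f)"
      using False by (intro c0_eqI) (simp add: c0_scale.rep_eq)
    then have "norm f \<le> norm (1 / c) * norm (c0_scale c f)"
      by (metis le)
    then have "norm c * norm f \<le> norm (c0_scale c f)"
      using False by (simp add: norm_divide field_simps)
    with le[of c f] show ?thesis by simp
  qed
qed (auto intro!: c0_eqI simp: c0_scale.rep_eq algebra_simps scaleR_conv_of_real)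

end

theory Submission
  imports Defs
begin

text \<open>
  An operator \<open>T\<close> from \<open>X\<close> into \<open>C\<^sub>0(K)\<close> is a weak-star continuous family \<open>U t = \<delta>\<^sub>t \<circ> T\<close> of
  functionals on \<open>X\<close>, and its norm is the supremum of the norms of the \<open>U t\<close>.  If \<open>T\<close> almost attains
  its norm at \<open>x0\<close>, some \<open>U t0\<close> almost attains the value one at \<open>x0\<close>.  By the
  Bishop-Phelps-Bollobas theorem for functionals there are a norm-one functional \<open>v\<close> close to
  \<open>U t0\<close> and a unit vector \<open>x\<close> close to \<open>x0\<close> with \<open>\<bar>v x\<bar> = 1\<close>.  The family
  \<open>U t + g t * (v - U t0)\<close>, with a compactly supported bump \<open>g\<close> that equals one at \<open>t0\<close>, passes
  through \<open>v\<close> and stays close to \<open>U\<close>, but it can leave the unit ball of the dual, and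
  normalizing it pointwise can destroy weak-star continuity,
  because the norm is only lower semicontinuous in that topology.  The approximate nearest
  point map repairs exactly this.  It returns the family continuously to the ball, moves it
  little because the family was never far from the ball, and fixes what already lies in
  the ball, in particular \<open>v\<close>.  The family obtained defines the required operator
  (\<open>BPB_property_c0\<close>).

  For functionals, the Bishop-Phelps-Bollobas theorem (\<open>bishop_phelps_bollobas_real\<close>) combines
  two principles.  Ekeland's principle (\<open>ekeland_principle\<close>) replaces \<open>x0\<close> by a nearby
  point \<open>z\<close> of the ball at which \<open>u\<close> is maximal up to a slope \<open>c\<close>, and separation on a cone
  (\<open>sandwich_on_cone\<close>) finds a functional of norm at most \<open>c\<close> whose subtraction makes \<open>z\<close> an
  actual maximum point.  The separation is a form of the Hahn-Banach theorem, proved by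
  observing that minimal sublinear functions are linear.  Complex scalars reduce to real ones
  by passing to real parts (\<open>functional_BPB_complex\<close>).
\<close>

section \<open>The Hahn-Banach theorem for sublinear functions\<close>

text \<open>
  Homogeneity is required only as an inequality for positive factors, because this is what
  infima of sublinear functions inherit directly; equality for all nonnegative factors follows
  (\<open>sublinear_scaleR\<close>).
\<close>

definition sublinear :: "('a::real_vector \<Rightarrow> real) \<Rightarrow> bool"
  where "sublinear p \<longleftrightarrow>
    (\<forall>x y. p (x + y) \<le> p x + p y) \<and> (\<forall>r x. 0 < r \<longrightarrow> p (r *\<^sub>R x) \<le> r * p x)"

lemma sublinear_add: "sublinear p \<Longrightarrow> p (x + y) \<le> p x + p y"
  by (simp add: sublinear_def)

lemma sublinear_scaleR:
  assumes "sublinear p" and "0 \<le> r"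
  shows "p (r *\<^sub>R x) = r * p x"
proof -
  have le: "p (s *\<^sub>R y) \<le> s * p y" if "0 < s" for s y
    using assms(1) that by (simp add: sublinear_def)
  show ?thesis
  proof (cases "r = 0")
    case True
    then show ?thesis using le[of "1/2" 0] le[of 2 0] by simp
  next
    case False
    with assms(2) have r: "0 < r" by simp
    have "p x \<le> inverse r * p (r *\<^sub>R x)"
      using le[of "inverse r" "r *\<^sub>R x"] r by simp
    then have "r * p x \<le> p (r *\<^sub>R x)"
      using r by (simp add: field_simps)
    with le[OF r, of x] show ?thesis by simp
  qed
qed

lemma sublinear_zero: "sublinear p \<Longrightarrow> p 0 = 0"
  using sublinear_scaleR[of p 0 0] by simp

lemma sublinear_lower: "sublinear p \<Longrightarrow> - p (- x) \<le> p x"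
  using sublinear_add[of p x "- x"] by (simp add: sublinear_zero)

text \<open>
  Subadditivity passes to the pointwise infimum because any two members of a chain have a
  common lower bound in it.  The infimum is finite because every member is at least
  \<open>- p0 (- x)\<close> for a fixed member \<open>p0\<close>.
\<close>

lemma sublinear_Inf_chain:
  fixes C :: "('a::real_vector \<Rightarrow> real) set"
  assumes "C \<noteq> {}" and sub: "\<And>p. p \<in> C \<Longrightarrow> sublinear p"
    and chain: "\<And>p q. p \<in> C \<Longrightarrow> q \<in> C \<Longrightarrow> p \<le> q \<or> q \<le> p"
  obtains u where "sublinear u" and "\<And>p. p \<in> C \<Longrightarrow> u \<le> p"
proof
  define u where "u = (\<lambda>x. INF p\<in>C. p x)"
  obtain p0 where p0: "p0 \<in> C" using assms(1) by blast
  have lower: "- p0 (- x) \<le> p x" if "p \<in> C" for p x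
  proof -
    have "- p (- x) \<le> p x" "- p0 (- x) \<le> p0 x"
      using sublinear_lower[OF sub] that p0 by auto
    moreover have "p (- x) \<le> p0 (- x) \<or> p0 x \<le> p x"
      using chain[OF that p0] by (auto simp: le_fun_def)
    ultimately show ?thesis by linarith
  qed
  have bdd: "bdd_below ((\<lambda>p. p x) ` C)" for x
    using lower by (auto simp: bdd_below_def)
  have ule: "u x \<le> p x" if "p \<in> C" for p x
    unfolding u_def by (rule cINF_lower[OF bdd that])
  have near: "\<exists>p\<in>C. p x < u x + e" if "0 < e" for x e
    using cINF_less_iff[OF assms(1) bdd, of x "u x + e"] that unfolding u_def by simp
  show "u \<le> p" if "p \<in> C" for p
    using ule[OF that] by (simp add: le_fun_def)
  show "sublinear u"
    unfolding sublinear_def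
  proof (intro conjI allI impI)
    fix x y
    show "u (x + y) \<le> u x + u y"
    proof (rule field_le_epsilon)
      fix e :: real assume "0 < e"
      then obtain p q where pq: "p \<in> C" "p x < u x + e/2" "q \<in> C" "q y < u y + e/2"
        using near[of "e/2"] by (metis half_gt_zero)
      obtain r where r: "r \<in> C" "r \<le> p" "r \<le> q"
        using chain[OF pq(1,3)] pq(1,3) by blast
      have "u (x + y) \<le> r (x + y)" by (rule ule[OF r(1)])
      also have "\<dots> \<le> r x + r y" by (rule sublinear_add[OF sub[OF r(1)]])
      also have "\<dots> \<le> p x + q y" using r(2,3) by (intro add_mono) (auto simp: le_fun_def)
      finally show "u (x + y) \<le> u x + u y + e" using pq(2,4) by linarith
    qed
  next
    fix r :: real and x assume r: "0 < r"
    show "u (r *\<^sub>R x) \<le> r * u x"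
    proof (rule field_le_epsilon)
      fix e :: real assume "0 < e"
      then obtain p where p: "p \<in> C" "p x < u x + e / r"
        using near r by (meson divide_pos_pos)
      have "u (r *\<^sub>R x) \<le> r * p x"
        using ule[OF p(1), of "r *\<^sub>R x"] sublinear_scaleR[OF sub[OF p(1)], of r x] r by simp
      also have "\<dots> \<le> r * (u x + e / r)" using p(2) r by simp
      finally show "u (r *\<^sub>R x) \<le> r * u x + e" using r by (simp add: algebra_simps)
    qed
  qed
qed

text \<open>
  The witness \<open>q x = (INF k\<in>K. p (x + k) - h k)\<close> is the largest sublinear function below \<open>p\<close> with
  \<open>q (- k) \<le> - h k\<close> on \<open>K\<close>.  A linear \<open>l \<le> q\<close> then satisfies \<open>h \<le> l\<close> on \<open>K\<close> and \<open>l \<le> p\<close>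
  everywhere.  The same construction on a ray, with \<open>h = p\<close>, shows that minimal sublinear
  functions are linear.
\<close>

lemma sublinear_cone_reduction:
  fixes p h :: "'a::real_vector \<Rightarrow> real"
  assumes p: "sublinear p" and K: "convex_cone K"
    and h_add: "\<And>k l. k \<in> K \<Longrightarrow> l \<in> K \<Longrightarrow> h k + h l \<le> h (k + l)"
    and h_scale: "\<And>r k. 0 < r \<Longrightarrow> k \<in> K \<Longrightarrow> r * h k \<le> h (r *\<^sub>R k)"
    and hp: "\<And>k. k \<in> K \<Longrightarrow> h k \<le> p k"
  obtains q where "sublinear q" and "q \<le> p" and "\<And>k. k \<in> K \<Longrightarrow> q (- k) \<le> - h k"
proof
  define q where "q = (\<lambda>x. INF k\<in>K. p (x + k) - h k)"
  have K0: "0 \<in> K" and ne: "K \<noteq> {}"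
    using K convex_cone_contains_0 by auto
  have "- p (- x) \<le> p (x + k) - h k" if "k \<in> K" for x k
  proof -
    have "p k \<le> p (x + k) + p (- x)"
      using sublinear_add[OF p, of "x + k" "- x"] by simp
    with hp[OF that] show ?thesis by linarith
  qed
  then have bdd: "bdd_below ((\<lambda>k. p (x + k) - h k) ` K)" for x
    by (auto simp: bdd_below_def)
  have qle: "q x \<le> p (x + k) - h k" if "k \<in> K" for x k
    unfolding q_def by (rule cINF_lower[OF bdd that])
  have near: "\<exists>k\<in>K. p (x + k) - h k < q x + e" if "0 < e" for x e
    using cINF_less_iff[OF ne bdd, of x "q x + e"] that unfolding q_def by simp
  have h0: "0 \<le> h 0"
    using h_scale[of 2 0] h_scale[of "1/2" 0] K0 by simp
  show "q \<le> p"
  proof (rule le_funI)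
    show "q x \<le> p x" for x using qle[OF K0, of x] h0 by simp
  qed
  show "q (- k) \<le> - h k" if "k \<in> K" for k
    using qle[OF that, of "- k"] by (simp add: sublinear_zero[OF p])
  show "sublinear q"
    unfolding sublinear_def
  proof (intro conjI allI impI)
    fix x y
    show "q (x + y) \<le> q x + q y"
    proof (rule field_le_epsilon)
      fix e :: real assume "0 < e"
      then obtain k l where kl: "k \<in> K" "p (x + k) - h k < q x + e/2"
          "l \<in> K" "p (y + l) - h l < q y + e/2"
        using near[of "e/2"] by (metis half_gt_zero)
      have "q (x + y) \<le> p ((x + k) + (y + l)) - h (k + l)"
        using qle[OF convex_cone_add[OF K kl(1,3)], of "x + y"] by (simp add: algebra_simps)
      also have "\<dots> \<le> (p (x + k) + p (y + l)) - (h k + h l)"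
        by (intro diff_mono sublinear_add p h_add kl)
      finally show "q (x + y) \<le> q x + q y + e" using kl(2,4) by linarith
    qed
  next
    fix r :: real and x assume r: "0 < r"
    show "q (r *\<^sub>R x) \<le> r * q x"
    proof (rule field_le_epsilon)
      fix e :: real assume "0 < e"
      then obtain k where k: "k \<in> K" "p (x + k) - h k < q x + e / r"
        using near r by (meson divide_pos_pos)
      have "q (r *\<^sub>R x) \<le> p (r *\<^sub>R (x + k)) - h (r *\<^sub>R k)"
        using qle[OF convex_cone_scaleR[OF K _ k(1)], of r "r *\<^sub>R x"] r
        by (simp add: scaleR_add_right)
      also have "\<dots> \<le> r * p (x + k) - r * h k"
        using h_scale[OF r k(1)] sublinear_scaleR[OF p, of r] r by simp
      also have "\<dots> = r * (p (x + k) - h k)" by (simp add: algebra_simps)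
      also have "\<dots> \<le> r * (q x + e / r)" using k(2) r by simp
      finally show "q (r *\<^sub>R x) \<le> r * q x + e" using r by (simp add: algebra_simps)
    qed
  qed
qed

text \<open>
  The reduction of \<open>p\<close> along the ray through \<open>a\<close> is again \<open>p\<close> by minimality, and this says
  \<open>p (- a) \<le> - p a\<close>.  This is the reverse of the inequality that sublinearity gives.
\<close>

lemma minimal_sublinear_imp_linear:
  fixes p :: "'a::real_vector \<Rightarrow> real"
  assumes p: "sublinear p" and minimal: "\<And>q. sublinear q \<Longrightarrow> q \<le> p \<Longrightarrow> q = p"
  shows "linear p"
proof -
  have super: "p x + p a \<le> p (x + a)" for x a
  proof -
    define K where "K = (\<lambda>t. t *\<^sub>R a) ` {0..}"
    have K_iff: "k \<in> K \<longleftrightarrow> (\<exists>t\<ge>0. k = t *\<^sub>R a)" for k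
      by (auto simp: K_def)
    have K: "convex_cone K"
      unfolding convex_cone_iff
    proof (intro conjI ballI allI impI)
      show "0 \<in> K" unfolding K_iff by (rule exI[of _ 0]) simp
      show "x + y \<in> K" if "x \<in> K" "y \<in> K" for x y
        using that unfolding K_iff by (metis add_nonneg_nonneg scaleR_add_left)
      show "r *\<^sub>R x \<in> K" if "x \<in> K" "0 \<le> r" for x r
        using that unfolding K_iff by (metis mult_nonneg_nonneg scaleR_scaleR)
    qed
    have aK: "a \<in> K"
      unfolding K_def by (intro image_eqI[of _ _ 1]) auto
    have addK: "p k + p l \<le> p (k + l)" if "k \<in> K" "l \<in> K" for k l
    proof -
      obtain s t where st: "0 \<le> s" "k = s *\<^sub>R a" "0 \<le> t" "l = t *\<^sub>R a"
        using \<open>k \<in> K\<close> \<open>l \<in> K\<close> unfolding K_iff by blast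
      then have "p (k + l) = (s + t) * p a"
        using sublinear_scaleR[OF p, of "s + t" a] by (simp add: scaleR_add_left)
      also have "\<dots> = p k + p l"
        using st by (simp add: sublinear_scaleR[OF p] distrib_right)
      finally show ?thesis by simp
    qed
    have scaleK: "r * p k \<le> p (r *\<^sub>R k)" if "0 < r" for r k
      using sublinear_scaleR[OF p, of r k] that by simp
    obtain q where q: "sublinear q" "q \<le> p" "\<And>k. k \<in> K \<Longrightarrow> q (- k) \<le> - p k"
      using sublinear_cone_reduction[OF p K addK scaleK order_refl] by blast
    have "p (- a) \<le> - p a" using q(3)[OF aK] minimal[OF q(1,2)] by simp
    then show ?thesis using sublinear_add[OF p, of "x + a" "- a"] by simp
  qed
  have add: "p (x + y) = p x + p y" for x y
    using super sublinear_add[OF p] by (intro antisym)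
  have minus: "p (- x) = - p x" for x
    using add[of x "- x"] by (simp add: sublinear_zero[OF p])
  have "p (r *\<^sub>R x) = r * p x" for r x
    using sublinear_scaleR[OF p, of r x] sublinear_scaleR[OF p, of "- r" x] minus[of "r *\<^sub>R x"]
    by (cases "0 \<le> r") auto
  with add show ?thesis by (intro linearI) auto
qed

text \<open>
  Zorn's lemma applied to the sublinear functions below \<open>p\<close>, ordered downwards, gives a minimal
  one.
\<close>

theorem hahn_banach_sublinear:
  fixes p :: "'a::real_vector \<Rightarrow> real"
  assumes p: "sublinear p"
  obtains l where "linear l" and "l \<le> p"
proof -
  let ?A = "{q. sublinear q \<and> q \<le> p}"
  have "\<exists>m\<in>?A. \<forall>q\<in>?A. q \<le> m \<longrightarrow> q = m"
  proof (rule predicate_Zorn[where P = "\<lambda>a b. b \<le> a"])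
    show "partial_order_on ?A (relation_of (\<lambda>a b. b \<le> a) ?A)"
      by (rule partial_order_on_relation_ofI) auto
  next
    fix C assume C: "C \<in> Chains (relation_of (\<lambda>a b. b \<le> a) ?A)"
    then have CA: "C \<subseteq> ?A" and chain: "\<And>a b. a \<in> C \<Longrightarrow> b \<in> C \<Longrightarrow> a \<le> b \<or> b \<le> a"
      by (auto simp: Chains_def relation_of_def)
    show "\<exists>u\<in>?A. \<forall>a\<in>C. u \<le> a"
    proof (cases "C = {}")
      case True
      then show ?thesis using p by auto
    next
      case False
      then obtain u where "sublinear u" "\<And>a. a \<in> C \<Longrightarrow> u \<le> a"
        using sublinear_Inf_chain[of C] CA chain by (metis (mono_tags, lifting) mem_Collect_eq subsetD)
      moreover obtain a where "a \<in> C" using False by blast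
      ultimately show ?thesis using CA by (blast intro: order_trans)
    qed
  qed
  then obtain m where m: "sublinear m" "m \<le> p" "\<And>q. sublinear q \<Longrightarrow> q \<le> p \<Longrightarrow> q \<le> m \<Longrightarrow> q = m"
    by blast
  then have "linear m"
    by (intro minimal_sublinear_imp_linear) (blast intro: order_trans)+
  with m(2) show ?thesis using that by blast
qed

text \<open>
  Separation by a functional: the sublinear bound is \<open>c * norm x\<close>, so the linear functional below
  the reduction is automatically continuous.
\<close>

theorem sandwich_on_cone:
  fixes u :: "'a::real_normed_vector \<Rightarrow>\<^sub>L real"
  assumes K: "convex_cone K" and "0 \<le> c" and uK: "\<And>k. k \<in> K \<Longrightarrow> u k \<le> c * norm k"
  obtains l :: "'a \<Rightarrow>\<^sub>L real" where "norm l \<le> c" and "\<And>k. k \<in> K \<Longrightarrow> u k \<le> l k"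
proof -
  let ?p = "\<lambda>x::'a. c * norm x"
  have p: "sublinear ?p"
    unfolding sublinear_def using \<open>0 \<le> c\<close>
    by (auto simp: distrib_left[symmetric] intro!: mult_left_mono norm_triangle_ineq)
  obtain q where q: "sublinear q" "q \<le> ?p" "\<And>k. k \<in> K \<Longrightarrow> q (- k) \<le> - u k"
    using sublinear_cone_reduction[OF p K, of "blinfun_apply u"] uK
    by (auto simp: blinfun.add_right blinfun.scaleR_right)
  obtain l where l: "linear l" "l \<le> q" using hahn_banach_sublinear[OF q(1)] .
  have le: "l x \<le> c * norm x" for x
    using l(2) q(2) by (auto simp: le_fun_def intro: order_trans)
  have abs: "\<bar>l x\<bar> \<le> c * norm x" for x
    using le[of x] le[of "- x"] linear_neg[OF l(1), of x] by simp
  then have bl: "bounded_linear l"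
    using l(1) by (intro bounded_linear.intro bounded_linear_axioms.intro exI[of _ c])
      (auto simp: mult.commute)
  show ?thesis
  proof
    show "norm (Blinfun l) \<le> c"
      using abs \<open>0 \<le> c\<close> by (intro norm_blinfun_bound) (auto simp: bounded_linear_Blinfun_apply[OF bl])
    show "u k \<le> Blinfun l k" if "k \<in> K" for k
    proof -
      have "l (- k) \<le> - u k" using l(2) q(3)[OF that] by (meson le_funD order_trans)
      then show ?thesis
        by (simp add: bounded_linear_Blinfun_apply[OF bl] linear_neg[OF l(1)])
    qed
  qed
qed

section \<open>Ekeland's variational principle and the Bishop-Phelps-Bollobas theorem\<close>

text \<open>
  Order \<open>S\<close> by \<open>x \<le> y\<close> iff \<open>c * dist x y \<le> f y - f x\<close>, and let \<open>R x\<close> be the points above \<open>x\<close>.  Going up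
  from \<open>x0\<close>, each time to a point of \<open>R x\<close> where \<open>f\<close> is almost maximal, makes the diameters of the
  closed sets \<open>R x\<close> shrink to zero.  Their only common point is maximal for the order.
\<close>

theorem ekeland_principle:
  fixes f :: "'a::complete_space \<Rightarrow> real"
  assumes S: "closed S" "x0 \<in> S" and f: "continuous_on S f" "bdd_above (f ` S)" and c: "0 < c"
  obtains z where "z \<in> S" and "c * dist x0 z \<le> f z - f x0"
    and "\<And>y. y \<in> S \<Longrightarrow> f y - f z \<le> c * dist z y"
proof -
  define R where "R x = {y \<in> S. c * dist x y \<le> f y - f x}" for x
  have R_refl: "x \<in> R x" if "x \<in> S" for x
    using that by (simp add: R_def)
  have R_sub: "R x \<subseteq> S" for x by (auto simp: R_def)
  have R_mono: "R y \<subseteq> R x" if "y \<in> R x" for x y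
  proof
    fix w assume w: "w \<in> R y"
    have "c * dist x w \<le> c * (dist x y + dist y w)"
      using c by (intro mult_left_mono dist_triangle) auto
    with w that show "w \<in> R x" by (auto simp: R_def algebra_simps)
  qed
  have R_closed: "closed (R x)" for x
  proof -
    have "continuous_on S (\<lambda>y. f y - f x - c * dist x y)"
      by (intro continuous_intros f(1))
    then have "closed (S \<inter> (\<lambda>y. f y - f x - c * dist x y) -` {0..})"
      using S(1) by (rule continuous_closed_preimage) simp
    also have "S \<inter> (\<lambda>y. f y - f x - c * dist x y) -` {0..} = R x"
      by (auto simp: R_def)
    finally show ?thesis .
  qed
  have step: "\<exists>y. y \<in> R x \<and> (\<forall>w\<in>R x. f w \<le> f y + e)" if x: "x \<in> S" and e: "0 < e" for x and e :: real
  proof -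
    have ne: "R x \<noteq> {}" using R_refl x by blast
    have bdd: "bdd_above (f ` R x)" using f(2) R_sub by (meson bdd_above_mono image_mono)
    obtain y where y: "y \<in> R x" "Sup (f ` R x) - e < f y"
      using less_cSUP_iff[OF ne bdd, of "Sup (f ` R x) - e"] e by auto
    have "f w \<le> f y + e" if "w \<in> R x" for w
      using cSUP_upper[OF that bdd] y(2) by linarith
    with y show ?thesis by blast
  qed
  have "\<exists>X. \<forall>n. (X n \<in> S \<and> (n = 0 \<longrightarrow> X n = x0)) \<and>
          (X (Suc n) \<in> R (X n) \<and> (\<forall>w\<in>R (X n). f w \<le> f (X (Suc n)) + (1/2)^n))"
  proof (rule dependent_nat_choice)
    show "\<exists>x. x \<in> S \<and> (0 = (0::nat) \<longrightarrow> x = x0)" using S by auto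
  next
    fix x and n :: nat assume "x \<in> S \<and> (n = 0 \<longrightarrow> x = x0)"
    then show "\<exists>y. (y \<in> S \<and> (Suc n = 0 \<longrightarrow> y = x0)) \<and>
        (y \<in> R x \<and> (\<forall>w\<in>R x. f w \<le> f y + (1/2)^n))"
      using step[of x "(1/2)^n"] R_sub by auto
  qed
  then obtain X where X: "\<And>n. X n \<in> S" "X 0 = x0" "\<And>n. X (Suc n) \<in> R (X n)"
      "\<And>n w. w \<in> R (X n) \<Longrightarrow> f w \<le> f (X (Suc n)) + (1/2)^n"
    by blast
  have "\<exists>a. \<Inter>(range (\<lambda>n. R (X n))) = {a}"
  proof (rule decreasing_closed_nest_sing)
    show "closed (R (X n))" for n by (rule R_closed)
    show "R (X n) \<noteq> {}" for n using R_refl X(1) by blast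
    show "R (X n) \<subseteq> R (X m)" if "m \<le> n" for m n
      by (rule lift_Suc_antimono_le[of "\<lambda>n. R (X n)", OF _ that]) (rule R_mono[OF X(3)])
  next
    fix e :: real assume "0 < e"
    then obtain n where n: "(1/2)^n < c * e / 2"
      using real_arch_pow_inv[of "c * e / 2" "1/2"] c by auto
    have near: "dist (X (Suc n)) y < e / 2" if y: "y \<in> R (X (Suc n))" for y
    proof -
      have "y \<in> R (X n)" using R_mono[OF X(3)] y by blast
      then have "c * dist (X (Suc n)) y \<le> (1/2)^n"
        using X(4)[of y n] y by (auto simp: R_def)
      with n have "c * dist (X (Suc n)) y < c * (e / 2)" by simp
      then show ?thesis using c by (simp only: mult_less_cancel_left_pos)
    qed
    have "dist x y < e" if "x \<in> R (X (Suc n))" "y \<in> R (X (Suc n))" for x y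
      using near[OF that(1)] near[OF that(2)] by (rule dist_triangle_half_r)
    then show "\<exists>n. \<forall>x\<in>R (X n). \<forall>y\<in>R (X n). dist x y < e" by blast
  qed
  then obtain a where "\<Inter>(range (\<lambda>n. R (X n))) = {a}" by blast
  then have a: "a \<in> R (X n)" and uniq: "(\<And>n. b \<in> R (X n)) \<Longrightarrow> b = a" for n b
    by auto
  show ?thesis
  proof
    show "a \<in> S" using a R_sub by blast
    show "c * dist x0 a \<le> f a - f x0" using a[of 0] by (simp add: R_def X(2))
    show "f y - f a \<le> c * dist a y" if "y \<in> S" for y
    proof (rule ccontr)
      assume *: "\<not> f y - f a \<le> c * dist a y"
      then have "y \<in> R a" using that by (simp add: R_def)
      then have "y = a" using R_mono[OF a] uniq by blast
      with * show False by simp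
    qed
  qed
qed

text \<open>
  Ekeland's principle on the unit ball gives a point \<open>z\<close> near \<open>x0\<close> with
  \<open>u y - u z \<le> c * norm (y - z)\<close> on the ball.  The inequality persists on the cone generated by the
  ball minus \<open>z\<close>, so there is a functional \<open>l\<close> of norm at most \<open>c\<close> that dominates \<open>u\<close> on that cone.
  Then \<open>u - l\<close> attains its maximum over the ball at \<open>z\<close>.  Normalizing it costs at most \<open>2 * c\<close>,
  since \<open>c \<le> 1/2\<close> keeps its norm between \<open>1 - 2 * c\<close> and \<open>1 + c\<close>.
\<close>

theorem bishop_phelps_bollobas_real:
  fixes u :: "'a::banach \<Rightarrow>\<^sub>L real"
  assumes u: "norm u \<le> 1" and x0: "norm x0 = 1" and c: "0 < c" "c \<le> 1/2"
    and near: "u x0 > 1 - c\<^sup>2"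
  obtains v :: "'a \<Rightarrow>\<^sub>L real" and z
    where "norm v = 1" "norm z = 1" "v z = 1" "norm (x0 - z) < c" "norm (u - v) \<le> 3 * c"
proof -
  have u_le: "u y \<le> 1" if "norm y \<le> 1" for y
    using norm_blinfun[of u y] mult_mono[OF u that] by simp
  obtain z where z: "norm z \<le> 1" "c * dist x0 z \<le> u z - u x0"
      "\<And>y. norm y \<le> 1 \<Longrightarrow> u y - u z \<le> c * dist z y"
  proof (rule ekeland_principle[of "cball 0 1" x0 "blinfun_apply u" c])
    show "bdd_above (blinfun_apply u ` cball 0 1)"
      using u_le by (intro bdd_aboveI[of _ 1]) auto
  qed (use x0 c in \<open>auto intro!: continuous_intros\<close>)
  have "c * dist x0 z < c * c"
    using z(2) u_le[OF z(1)] near by (simp add: power2_eq_square)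
  then have dist: "norm (x0 - z) < c"
    using c by (simp add: dist_norm)
  define K where "K = convex_cone hull ((\<lambda>y. y - z) ` cball 0 1)"
  have K_eq: "K = (\<Union>y\<in>cball 0 1. \<Union>s\<in>{0..}. {s *\<^sub>R (y - z)})"
    unfolding K_def by (subst convex_cone_hull_convex_hull_nonempty)
      (auto simp: convex_hull_eq[THEN iffD2] convex_translation_subtract)
  have "u k \<le> c * norm k" if k: "k \<in> K" for k
  proof -
    obtain y s where ys: "norm y \<le> 1" "0 \<le> s" "k = s *\<^sub>R (y - z)" using k by (auto simp: K_eq)
    have "u k = s * (u y - u z)"
      by (simp add: ys(3) blinfun.scaleR_right blinfun.diff_right)
    also have "\<dots> \<le> s * (c * norm (y - z))"
      using z(3)[OF ys(1)] ys(2) by (intro mult_left_mono) (auto simp: dist_norm norm_minus_commute)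
    finally show ?thesis using ys(2,3) by (simp add: mult_ac)
  qed
  then obtain l :: "'a \<Rightarrow>\<^sub>L real" where l: "norm l \<le> c" "\<And>k. k \<in> K \<Longrightarrow> u k \<le> l k"
    using sandwich_on_cone[of K c u] c by (auto simp: K_def convex_cone_convex_cone_hull)
  define w where "w = u - l"
  have w_max: "w y \<le> w z" if "norm y \<le> 1" for y
  proof -
    have "y - z \<in> K" using that unfolding K_def by (intro hull_inc) auto
    from l(2)[OF this] show ?thesis by (simp add: w_def blinfun.diff_right blinfun.diff_left)
  qed
  have w_norm_le: "norm w \<le> w z"
  proof (rule norm_blinfun_bound)
    show "0 \<le> w z" using w_max[of 0] by simp
    fix y
    have "\<bar>w (y /\<^sub>R norm y)\<bar> \<le> w z" if "y \<noteq> 0"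
      using w_max[of "y /\<^sub>R norm y"] w_max[of "- (y /\<^sub>R norm y)"] that
      by (simp add: blinfun.minus_right)
    then show "norm (w y) \<le> w z * norm y"
      by (cases "y = 0") (auto simp: blinfun.scaleR_right abs_mult field_simps)
  qed
  have uw: "norm (u - w) \<le> c" using l(1) by (simp add: w_def)
  have c2: "c\<^sup>2 \<le> c / 2"
    using c mult_left_mono[of c "1/2" c] by (simp add: power2_eq_square)
  have "l x0 \<le> c" using norm_blinfun[of l x0] l(1) x0 by simp
  then have w_ge: "1 - c\<^sup>2 - c \<le> norm w"
    using norm_blinfun[of w x0] near x0 by (simp add: w_def blinfun.diff_left)
  then have w_pos: "0 < norm w" using c c2 by linarith
  have w_le: "norm w \<le> 1 + c" using norm_triangle_ineq4[of u l] u l(1) by (simp add: w_def)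
  have wz: "w z \<le> norm w * norm z" using norm_blinfun[of w z] by simp
  have "norm z \<ge> 1"
    using order_trans[OF w_norm_le wz] w_pos by (simp add: mult_le_cancel_left1)
  with z(1) have nz: "norm z = 1" by simp
  have wz_eq: "w z = norm w" using wz w_norm_le nz by simp
  define v where "v = w /\<^sub>R norm w"
  have "w - v = (1 - inverse (norm w)) *\<^sub>R w" by (simp add: v_def algebra_simps)
  then have "norm (w - v) = \<bar>1 - inverse (norm w)\<bar> * \<bar>norm w\<bar>" by simp
  also have "\<dots> = \<bar>norm w - 1\<bar>"
    unfolding abs_mult[symmetric] using w_pos by (simp add: left_diff_distrib)
  finally have "norm (w - v) = \<bar>norm w - 1\<bar>" .
  then have "norm (w - v) \<le> 2 * c" using w_ge w_le c2 c by linarith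
  moreover have "norm (u - v) \<le> norm (u - w) + norm (w - v)"
    by (metis diff_add_cancel add_diff_eq norm_triangle_ineq)
  ultimately have "norm (u - v) \<le> 3 * c" using uw by linarith
  moreover have "norm v = 1" "v z = 1"
    using w_pos by (auto simp: v_def blinfun.scaleR_left wz_eq)
  ultimately show ?thesis using that nz dist by blast
qed

section \<open>Norm-attaining approximation of real and complex functionals\<close>

text \<open>
  Allowing every functional in the unit ball, rather than only those of norm one, is what
  makes the property applicable to the functionals \<open>\<delta>\<^sub>t \<circ> T\<close>, whose norms may lie strictly
  below \<open>norm T = 1\<close>.
\<close>

definition functional_BPB :: "('k::real_normed_field \<Rightarrow> 'x::banach \<Rightarrow> 'x) \<Rightarrow> bool"
  where "functional_BPB s \<longleftrightarrow>
    (\<forall>\<epsilon>>0. \<exists>\<eta>>0. \<forall>u\<in>dual s. \<forall>x0\<in>sphere 0 1.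
      norm u \<le> 1 \<and> norm (blinfun_apply u x0) > 1 - \<eta> \<longrightarrow>
      (\<exists>v\<in>dual s. \<exists>x\<in>sphere 0 1. norm v = 1 \<and> norm (blinfun_apply v x) = 1 \<and>
        norm (x0 - x) < \<epsilon> \<and> norm (u - v) < \<epsilon>))"

lemma functional_BPB_I:
  assumes "\<And>c u x0. 0 < c \<Longrightarrow> c \<le> 1/2 \<Longrightarrow> u \<in> dual s \<Longrightarrow> norm u \<le> 1 \<Longrightarrow> norm x0 = 1 \<Longrightarrow>
      norm (blinfun_apply u x0) > 1 - c\<^sup>2 \<Longrightarrow>
      \<exists>v\<in>dual s. \<exists>x. norm x = 1 \<and> norm v = 1 \<and> norm (blinfun_apply v x) = 1 \<and>
        norm (x0 - x) < c \<and> norm (u - v) \<le> 3 * c"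
  shows "functional_BPB s"
  unfolding functional_BPB_def
proof (intro allI impI)
  fix \<epsilon> :: real assume \<epsilon>: "0 < \<epsilon>"
  define c where "c = min (1/2) (\<epsilon> / 4)"
  have c: "0 < c" "c \<le> 1/2" "3 * c < \<epsilon>" using \<epsilon> by (auto simp: c_def min_def)
  show "\<exists>\<eta>>0. \<forall>u\<in>dual s. \<forall>x0\<in>sphere 0 1.
      norm u \<le> 1 \<and> norm (blinfun_apply u x0) > 1 - \<eta> \<longrightarrow>
      (\<exists>v\<in>dual s. \<exists>x\<in>sphere 0 1. norm v = 1 \<and> norm (blinfun_apply v x) = 1 \<and>
        norm (x0 - x) < \<epsilon> \<and> norm (u - v) < \<epsilon>)"
  proof (intro exI[of _ "c\<^sup>2"] conjI ballI impI)
    show "0 < c\<^sup>2" using c by simp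
    fix u x0 assume u: "u \<in> dual s" "x0 \<in> sphere 0 1"
      "norm u \<le> 1 \<and> norm (blinfun_apply u x0) > 1 - c\<^sup>2"
    have "norm x0 = 1" using u(2) by simp
    then obtain v x where "v \<in> dual s" "norm x = 1" "norm v = 1" "norm (blinfun_apply v x) = 1"
        "norm (x0 - x) < c" "norm (u - v) \<le> 3 * c"
      using assms[OF c(1,2) u(1)] u(3) by blast
    with c show "\<exists>v\<in>dual s. \<exists>x\<in>sphere 0 1. norm v = 1 \<and> norm (blinfun_apply v x) = 1 \<and>
        norm (x0 - x) < \<epsilon> \<and> norm (u - v) < \<epsilon>"
      by (intro bexI[of _ v] bexI[of _ x]) auto
  qed
qed

lemma dual_scale:
  assumes "u \<in> dual s"
  shows "blinfun_mult_right a o\<^sub>L u \<in> dual s"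
  using assms by (auto simp: dual_def operators_def)

lemma norm_blinfun_mult_right_compose_le:
  fixes u :: "'x::real_normed_vector \<Rightarrow>\<^sub>L 'k::real_normed_field"
  assumes "norm a = 1"
  shows "norm (blinfun_mult_right a o\<^sub>L u) \<le> norm u"
  by (rule norm_blinfun_bound) (auto simp: norm_mult assms norm_blinfun)

text \<open>
  A suitable unimodular scalar \<open>b\<close> makes the value of \<open>u\<close> at a given point real and
  positive; an approximation \<open>v\<close> of the rotated functional is carried back by \<open>a = 1 / b\<close>, with
  no change to norms or to the points where the norm is attained.
\<close>

lemma functional_rotation:
  fixes a b :: "'k::real_normed_field"
  assumes u: "u \<in> dual s" and b: "norm b = 1" "a * b = 1"
    and v: "v \<in> dual s" "norm v = 1" "norm (blinfun_apply v x) = 1"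
    and uv: "norm ((blinfun_mult_right b o\<^sub>L u) - v) \<le> d"
  shows "\<exists>w\<in>dual s. norm w = 1 \<and> norm (blinfun_apply w x) = 1 \<and> norm (u - w) \<le> d"
proof -
  let ?w = "blinfun_mult_right a o\<^sub>L v"
  have a: "norm a = 1" using arg_cong[OF b(2), of norm] b(1) by (simp add: norm_mult)
  have v': "v = blinfun_mult_right b o\<^sub>L ?w"
    using b(2) by (intro blinfun_eqI) (simp add: mult.assoc[symmetric] mult.commute[of b])
  have "norm ?w = 1"
    using norm_blinfun_mult_right_compose_le[OF a, of v] 
      norm_blinfun_mult_right_compose_le[OF b(1), of ?w] v(2) v' by simp
  moreover have "norm (blinfun_apply ?w x) = 1" using a v(3) by (simp add: norm_mult)
  moreover have "u - ?w = blinfun_mult_right a o\<^sub>L ((blinfun_mult_right b o\<^sub>L u) - v)"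
    using b(2) by (intro blinfun_eqI)
      (simp add: blinfun.diff_left right_diff_distrib mult.assoc[symmetric])
  then have "norm (u - ?w) \<le> d"
    using norm_blinfun_mult_right_compose_le[OF a] uv by (metis order_trans)
  ultimately show ?thesis using dual_scale[OF v(1)] by blast
qed

lemma functional_BPB_real:
  assumes "banach_over s"
  shows "functional_BPB (s :: real \<Rightarrow> 'x::banach \<Rightarrow> 'x)"
proof (rule functional_BPB_I)
  fix c :: real and u :: "'x \<Rightarrow>\<^sub>L real" and x0
  assume c: "0 < c" "c \<le> 1/2" and u: "u \<in> dual s" "norm u \<le> 1" and x0: "norm x0 = 1"
    and near: "norm (u x0) > 1 - c\<^sup>2"
  have dual: "v \<in> dual s" for v
    by (auto simp: dual_def operators_def banach_over_real_unique[OF assms] blinfun.scaleR_right)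
  have "c\<^sup>2 \<le> (1/2)\<^sup>2" using c by (intro power_mono) auto
  then have "u x0 \<noteq> 0" using near by (auto simp: power2_eq_square)
  define b where "b = sgn (u x0)"
  have b: "norm b = 1" "b * b = 1" "b * u x0 = norm (u x0)"
    using \<open>u x0 \<noteq> 0\<close> by (auto simp: b_def sgn_if)
  let ?u = "blinfun_mult_right b o\<^sub>L u"
  obtain v z where v: "norm v = 1" "norm z = 1" "blinfun_apply v z = 1" "norm (x0 - z) < c"
      "norm (?u - v) \<le> 3 * c"
  proof (rule bishop_phelps_bollobas_real[of ?u x0 c])
    show "norm ?u \<le> 1"
      using norm_blinfun_mult_right_compose_le[OF b(1), of u] u(2) by simp
  qed (use x0 c near b in auto)
  obtain w where "w \<in> dual s" "norm w = 1" "norm (blinfun_apply w z) = 1" "norm (u - w) \<le> 3 * c"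
    using functional_rotation[OF u(1) b(1,2) dual v(1) _ v(5), of z] v(3) by auto
  with v show "\<exists>v\<in>dual s. \<exists>x. norm x = 1 \<and> norm v = 1 \<and> norm (blinfun_apply v x) = 1 \<and>
      norm (x0 - x) < c \<and> norm (u - v) \<le> 3 * c"
    by blast
qed

text \<open>
  Every \<open>y\<close> can be rotated by a unimodular scalar so that \<open>u y\<close> becomes its own absolute value,
  and the rotation does not change \<open>norm y\<close>.  So real parts control the norm of a
  complex-linear functional.
\<close>

lemma norm_dual_le_Re:
  fixes s :: "complex \<Rightarrow> 'x::banach \<Rightarrow> 'x"
  assumes s: "banach_over s" and u: "u \<in> dual s" and M: "0 \<le> M"
    and le: "\<And>y. Re (blinfun_apply u y) \<le> M * norm y"
  shows "norm u \<le> M"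
proof (rule norm_blinfun_bound[OF M])
  fix y
  obtain a where a: "norm a = 1" "a * u y = of_real (norm (u y))"
  proof (cases "u y = 0")
    case True
    then show ?thesis using that[of 1] by simp
  next
    case False
    then show ?thesis
      using that[of "of_real (norm (u y)) / u y"] by (simp add: norm_divide)
  qed
  have "u (s a y) = of_real (norm (u y))"
    using u a(2) by (simp add: dual_def operators_def)
  then have "norm (u y) = Re (u (s a y))" by simp
  also have "\<dots> \<le> M * norm (s a y)" by (rule le)
  also have "\<dots> = M * norm y" by (simp add: banach_over.norm_scale[OF s] a(1))
  finally show "norm (u y) \<le> M * norm y" .
qed

text \<open>
  The functional is \<open>y \<mapsto> v y - \<i> * v (\<i> y)\<close>, where \<open>\<i> y\<close> is the given complex scaling.
\<close>

lemma complex_functional_of_real_part: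
  fixes s :: "complex \<Rightarrow> 'x::banach \<Rightarrow> 'x"
  assumes s: "banach_over s" and v: "bounded_linear (v :: 'x \<Rightarrow> real)"
  obtains V where "V \<in> dual s" and "\<And>y. Re (blinfun_apply V y) = v y"
proof -
  interpret banach_over s by (rule s)
  interpret v: bounded_linear v by (rule v)
  define F where "F y = Complex (v y) (- v (s \<i> y))" for y
  have split: "s c y = Re c *\<^sub>R y + Im c *\<^sub>R s \<i> y" for c y
  proof -
    have "s c y = s (of_real (Re c) + of_real (Im c) * \<i>) y"
      by (simp add: complex_eq mult.commute)
    then show ?thesis
      by (simp only: scale_left_distrib scale_scale[symmetric] scale_of_real)
  qed
  have Fc: "F (s c y) = c * F y" for c y
  proof -
    \<comment> \<open>At \<open>d = c\<close> this gives the real part of \<open>F (s c y)\<close>, at \<open>d = \<i> * c\<close> the imaginary part.\<close>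
    have v_split: "v (s d y) = Re d * v y + Im d * v (s \<i> y)" for d
      by (subst split) (simp add: v.add v.scaleR)
    show ?thesis
      using v_split[of c] v_split[of "\<i> * c"] by (simp add: F_def complex_eq_iff)
  qed
  obtain B where B: "0 < B" "\<And>y. norm (v y) \<le> norm y * B" using v.pos_bounded by blast
  have "bounded_linear F"
  proof (rule bounded_linear_intro)
    show "F (x + y) = F x + F y" for x y
      by (simp add: F_def complex_eq_iff v.add scale_right_distrib)
    show "F (r *\<^sub>R x) = r *\<^sub>R F x" for r x
      using Fc[of "of_real r" x] by (simp add: scale_of_real scaleR_conv_of_real)
    show "norm (F x) \<le> norm x * (B + B)" for x
    proof -
      have "norm (F x) \<le> \<bar>v x\<bar> + \<bar>v (s \<i> x)\<bar>"
        using cmod_le[of "F x"] by (simp add: F_def)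
      also have "\<dots> \<le> norm x * B + norm (s \<i> x) * B"
        using B(2)[of x] B(2)[of "s \<i> x"] by simp
      finally show ?thesis by (simp add: norm_scale mult_ac)
    qed
  qed
  then have "blinfun_apply (Blinfun F) = F" by (rule bounded_linear_Blinfun_apply)
  with Fc show ?thesis
    by (intro that[of "Blinfun F"]) (auto simp: dual_def operators_def F_def)
qed

lemma dual_diff: "u \<in> dual s \<Longrightarrow> v \<in> dual s \<Longrightarrow> u - v \<in> dual s"
  by (auto simp: dual_def operators_def blinfun.diff_left right_diff_distrib)

text \<open>
  The real theorem is applied to \<open>Re \<circ> u\<close>, after a rotation that makes \<open>u x0\<close> positive.  The
  norm of a difference of complex functionals is governed by its real part, so neither the norm
  nor the distance changes when the real functional obtained is complexified; the value \<open>1\<close> of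
  the real part at \<open>z\<close> together with norm at most \<open>1\<close> forces the norm to be attained at \<open>z\<close>.
\<close>

lemma functional_BPB_complex:
  assumes s: "banach_over s"
  shows "functional_BPB (s :: complex \<Rightarrow> 'x::banach \<Rightarrow> 'x)"
proof (rule functional_BPB_I)
  fix c :: real and u :: "'x \<Rightarrow>\<^sub>L complex" and x0
  assume c: "0 < c" "c \<le> 1/2" and u: "u \<in> dual s" "norm u \<le> 1" and x0: "norm x0 = 1"
    and near: "norm (u x0) > 1 - c\<^sup>2"
  have "c\<^sup>2 \<le> (1/2)\<^sup>2" using c by (intro power_mono) auto
  then have ux0: "u x0 \<noteq> 0" using near by (auto simp: power2_eq_square)
  define b where "b = of_real (norm (u x0)) / u x0"
  have b: "norm b = 1" "inverse b * b = 1" "b * u x0 = of_real (norm (u x0))"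
    using ux0 by (auto simp: b_def norm_divide)
  let ?u = "blinfun_mult_right b o\<^sub>L u"
  have u': "?u \<in> dual s" "norm ?u \<le> 1"
    using dual_scale[OF u(1)] norm_blinfun_mult_right_compose_le[OF b(1), of u] u(2) by auto
  have blr: "bounded_linear (\<lambda>y. Re (?u y))"
    by (intro bounded_linear_compose[OF bounded_linear_Re] blinfun.bounded_linear_right)
  define r where "r = Blinfun (\<lambda>y. Re (?u y))"
  have r: "r y = Re (?u y)" for y
    unfolding r_def by (subst bounded_linear_Blinfun_apply[OF blr]) simp
  have "norm r \<le> 1"
  proof (rule norm_blinfun_bound)
    fix y
    have "norm (r y) \<le> norm (?u y)" unfolding r real_norm_def by (rule abs_Re_le_cmod)
    also have "\<dots> \<le> 1 * norm y"
      using norm_blinfun[of ?u y] mult_right_mono[OF u'(2), of "norm y"] by simp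
    finally show "norm (r y) \<le> 1 * norm y" .
  qed simp
  moreover have "r x0 > 1 - c\<^sup>2" using near b(3) by (simp add: r)
  ultimately obtain v z where v: "norm v = 1" "norm z = 1" "blinfun_apply v z = 1"
      "norm (x0 - z) < c" "norm (r - v) \<le> 3 * c"
    using bishop_phelps_bollobas_real[of r x0 c] x0 c by blast
  obtain V where V: "V \<in> dual s" "\<And>y. Re (V y) = v y"
    using complex_functional_of_real_part[OF s blinfun.bounded_linear_right[of v]] by blast
  have "norm V \<le> 1"
  proof (rule norm_dual_le_Re[OF s V(1)])
    show "Re (V y) \<le> 1 * norm y" for y using norm_blinfun[of v y] v(1) by (simp add: V(2))
  qed simp
  moreover have "1 \<le> norm (V z)"
    using complex_Re_le_cmod[of "V z"] by (simp add: V(2) v(3))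
  moreover have "norm (V z) \<le> norm V" using norm_blinfun[of V z] v(2) by simp
  ultimately have V1: "norm V = 1" "norm (V z) = 1" by auto
  have "norm (?u - V) \<le> 3 * c"
  proof (rule norm_dual_le_Re[OF s dual_diff[OF u'(1) V(1)]])
    fix y
    have "Re ((?u - V) y) = (r - v) y"
      by (simp add: blinfun.diff_left V(2) r)
    also have "\<dots> \<le> norm (r - v) * norm y" using norm_blinfun[of "r - v" y] by simp
    also have "\<dots> \<le> 3 * c * norm y" using v(5) by (intro mult_right_mono) auto
    finally show "Re ((?u - V) y) \<le> 3 * c * norm y" .
  qed (use c in simp)
  from functional_rotation[OF u(1) b(1,2) V(1) V1 this]
  obtain w where "w \<in> dual s" "norm w = 1" "norm (blinfun_apply w z) = 1" "norm (u - w) \<le> 3 * c"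
    by blast
  with v show "\<exists>v\<in>dual s. \<exists>x. norm x = 1 \<and> norm v = 1 \<and> norm (blinfun_apply v x) = 1 \<and>
      norm (x0 - x) < c \<and> norm (u - v) \<le> 3 * c"
    by blast
qed

section \<open>Operators into spaces of continuous functions as families of functionals\<close>

lemma continuous_map_weak_star_iff:
  "continuous_map T (weak_star s) F \<longleftrightarrow>
    F \<in> topspace T \<rightarrow> dual s \<and> (\<forall>x. continuous_map T euclidean (\<lambda>t. blinfun_apply (F t) x))"
proof safe
  assume F: "continuous_map T (weak_star s) F"
  show "F t \<in> dual s" if "t \<in> topspace T" for t
    using continuous_map_image_subset_topspace[OF F] that by (auto simp: topspace_weak_star)
  fix x
  have "continuous_map (weak_star s) euclidean ((\<lambda>f. f x) \<circ> blinfun_apply)"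
    unfolding weak_star_def
    by (intro continuous_map_pullback)
      (simp add: continuous_on_product_coordinates)
  from continuous_map_compose[OF F this]
  show "continuous_map T euclidean (\<lambda>t. blinfun_apply (F t) x)" by (simp add: o_def)
next
  assume "F \<in> topspace T \<rightarrow> dual s" "\<forall>x. continuous_map T euclidean (\<lambda>t. blinfun_apply (F t) x)"
  then show "continuous_map T (weak_star s) F"
    unfolding weak_star_def
    by (intro continuous_map_pullback')
      (auto simp: o_def euclidean_product_topology[symmetric] continuous_map_componentwise_UNIV)
qed

text \<open>
  Operators into \<open>C\<^sub>0(K)\<close> are the same as bounded weak-star continuous families of functionals
  indexed by \<open>K\<close> that vanish at infinity pointwise.  This is the direction that builds an operator
  out of a family; the family of a given operator \<open>T\<close> is \<open>adjoint_eval T\<close> below.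
\<close>

lemma operator_of_weak_star_family:
  fixes \<Psi> :: "'a::topological_space \<Rightarrow> 'x::banach \<Rightarrow>\<^sub>L 'k::{real_normed_field,banach}"
  assumes cont: "continuous_map euclidean (weak_star s) \<Psi>"
    and bound: "\<And>t. norm (\<Psi> t) \<le> 1"
    and van: "\<And>x. vanishes_at_infinity (\<lambda>t. blinfun_apply (\<Psi> t) x)"
  obtains S where "S \<in> operators s c0_scale" "\<And>x t. c0_apply (blinfun_apply S x) t = \<Psi> t x" 
proof -
  define F where "F x = Abs_c0 (\<lambda>t. \<Psi> t x)" for x
  have "continuous_on UNIV (\<lambda>t. \<Psi> t x)" for x
    using cont by (auto simp: continuous_map_weak_star_iff)
  then have F: "c0_apply (F x) t = \<Psi> t x" for x t
    using van by (simp add: F_def Abs_c0_inverse)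
  have "bounded_linear F"
  proof (rule bounded_linear_intro)
    show "norm (F x) \<le> norm x * 1" for x
    proof (rule norm_c0_least)
      show "norm (c0_apply (F x) t) \<le> norm x * 1" for t
        using norm_blinfun[of "\<Psi> t" x] mult_right_mono[OF bound[of t], of "norm x"] by (simp add: F)
    qed
  qed (auto intro!: c0_eqI simp: F blinfun.add_right blinfun.scaleR_right)
  then have S: "blinfun_apply (Blinfun F) = F" by (rule bounded_linear_Blinfun_apply)
  have "\<Psi> t \<in> dual s" for t using cont by (auto simp: continuous_map_weak_star_iff)
  then have "Blinfun F \<in> operators s c0_scale"
    by (auto intro!: c0_eqI simp: operators_def dual_def S F c0_scale.rep_eq)
  with S F show ?thesis by (intro that[of "Blinfun F"]) auto
qed

lemma norm_c0_operator_le: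
  fixes S :: "'x::real_normed_vector \<Rightarrow>\<^sub>L ('a::topological_space, 'k::real_normed_field) c0"
  assumes "0 \<le> M" "\<And>t. norm (\<Psi> t :: 'x \<Rightarrow>\<^sub>L 'k) \<le> M"
    and "\<And>x t. c0_apply (blinfun_apply S x) t = \<Psi> t x"
  shows "norm S \<le> M"
proof (rule norm_blinfun_bound[OF assms(1)])
  fix x
  show "norm (S x) \<le> M * norm x"
  proof (rule norm_c0_least)
    show "norm (c0_apply (S x) t) \<le> M * norm x" for t
      using norm_blinfun[of "\<Psi> t" x] mult_right_mono[OF assms(2), of "norm x" t]
      by (simp add: assms(3))
  qed
qed

text \<open>
  The value at the point mass \<open>\<delta>\<^sub>t\<close> of the adjoint operator of \<open>T\<close>.
\<close>

definition adjoint_eval ::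
  "('x::real_normed_vector \<Rightarrow>\<^sub>L ('a::topological_space, 'k::real_normed_field) c0) \<Rightarrow> 'a \<Rightarrow> 'x \<Rightarrow>\<^sub>L 'k"
  where "adjoint_eval T t = Blinfun (\<lambda>x. c0_apply (blinfun_apply T x) t)"

lemma adjoint_eval_apply [simp]: "blinfun_apply (adjoint_eval T t) x = c0_apply (blinfun_apply T x) t"
proof -
  have "bounded_linear (\<lambda>x. c0_apply (blinfun_apply T x) t)"
    by (rule bounded_linear_intro[where K = "norm T"])
      (auto simp: blinfun.add_right blinfun.scaleR_right mult.commute[of _ "norm T"]
        intro: order_trans[OF norm_c0_upper norm_blinfun])
  then show ?thesis by (simp add: adjoint_eval_def bounded_linear_Blinfun_apply)
qed

lemma norm_adjoint_eval_le: "norm (adjoint_eval T t) \<le> norm T"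
  by (rule norm_blinfun_bound) (auto intro: order_trans[OF norm_c0_upper norm_blinfun])

lemma adjoint_eval_in_dual: "T \<in> operators s c0_scale \<Longrightarrow> adjoint_eval T t \<in> dual s"
  by (auto simp: dual_def operators_def c0_scale.rep_eq)

section \<open>Localized perturbation of an operator\<close>

text \<open>
  The bump is cut out of \<open>f\<close> itself: with \<open>m = norm (f t0)\<close>, the function
  \<open>2 * norm (f t) / m - 1\<close> equals \<open>1\<close> at \<open>t0\<close> and is at most \<open>0\<close> wherever \<open>norm (f t) \<le> m / 2\<close>, and
  \<open>norm (f t) \<ge> m / 2\<close> only on a compact set because \<open>f\<close> vanishes at infinity.
\<close>

lemma c0_peak_function:
  fixes f :: "('a::topological_space, 'k::real_normed_field) c0"
  assumes "c0_apply f t0 \<noteq> 0"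
  obtains g :: "'a \<Rightarrow> real" and C where "continuous_on UNIV g" "g t0 = 1" "\<And>t. 0 \<le> g t" "\<And>t. g t \<le> 1"
    "compact C" "\<And>t. t \<notin> C \<Longrightarrow> g t = 0"
proof -
  let ?m = "norm (c0_apply f t0)"
  define g where "g t = max 0 (min 1 (2 * norm (c0_apply f t) / ?m - 1))" for t
  have m: "0 < ?m" using assms by simp
  show ?thesis
  proof
    show "continuous_on UNIV g"
      unfolding g_def using m by (intro continuous_intros c0_continuous) auto
    show "compact {t. ?m / 2 \<le> norm (c0_apply f t)}"
      using c0_vanishes[of f] m unfolding vanishes_at_infinity_def by (metis half_gt_zero)
    show "g t = 0" if "t \<notin> {t. ?m / 2 \<le> norm (c0_apply f t)}" for t
      using that m by (auto simp: g_def max_def field_simps)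
  qed (use assms in \<open>auto simp: g_def\<close>)
qed

lemma vanishes_at_infinity_eq_off_compact:
  fixes f g :: "'a::topological_space \<Rightarrow> 'b::real_normed_vector"
  assumes "vanishes_at_infinity f" "continuous_on UNIV g" "compact C" "\<And>t. t \<notin> C \<Longrightarrow> g t = f t"
  shows "vanishes_at_infinity g"
  unfolding vanishes_at_infinity_def
proof (intro allI impI)
  fix e :: real assume "0 < e"
  then have "compact (C \<union> {t. e \<le> norm (f t)})"
    using assms(1,3) by (auto simp: vanishes_at_infinity_def)
  moreover have "closed {t. e \<le> norm (g t)}"
    by (intro closed_Collect_le continuous_intros assms(2))
  ultimately have "compact ((C \<union> {t. e \<le> norm (f t)}) \<inter> {t. e \<le> norm (g t)})"
    by (rule compact_Int_closed)
  also have "(C \<union> {t. e \<le> norm (f t)}) \<inter> {t. e \<le> norm (g t)} = {t. e \<le> norm (g t)}"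
    using assms(4) by fastforce
  finally show "compact {t. e \<le> norm (g t)}" .
qed

text \<open>
  With \<open>U t = \<delta>\<^sub>t \<circ> T\<close>, choose \<open>t0\<close> where \<open>T x0\<close> is almost of modulus one and correct
  \<open>U t0\<close> to a functional \<open>v\<close> that attains its norm near \<open>x0\<close>.  Adding \<open>g t * (v - U t0)\<close> to \<open>U t\<close>, for
  a bump \<open>g\<close> at \<open>t0\<close>, keeps the family weak-star continuous but may push it slightly out
  of the unit ball.  The map \<open>\<phi>\<close> brings it back at the cost of a small error.  A nearest point map
  fixes the ball, so \<open>v\<close> at \<open>t0\<close> survives, and so does \<open>U t\<close> wherever \<open>g t = 0\<close>; the latter makes
  the new functions vanish at infinity.
\<close>

theorem BPB_property_c0:
  fixes s :: "'k::{real_normed_field,banach} \<Rightarrow> 'x::banach \<Rightarrow> 'x"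
  assumes bpb_dual: "functional_BPB s" and npm: "admits_weak_star_approx_nearest_point_map s"
  shows "BPB_property s (c0_scale :: 'k \<Rightarrow> ('a::topological_space, 'k) c0 \<Rightarrow> ('a, 'k) c0)"
  unfolding BPB_property_def
proof (intro allI impI)
  fix \<epsilon> :: real assume "0 < \<epsilon> \<and> \<epsilon> < 1"
  then have \<epsilon>: "0 < \<epsilon>" by simp
  from npm obtain f \<phi> where f: "nearest_point_modulus f" and \<phi>: "approx_nearest_point_map s f \<phi>"
    and \<phi>_cont: "continuous_map (weak_star s) (weak_star s) \<phi>"
    unfolding admits_weak_star_approx_nearest_point_map_def by blast
  have "\<forall>\<^sub>F t in at_right 0. f t < \<epsilon> / 2"
    using f \<epsilon> unfolding nearest_point_modulus_def by (intro order_tendstoD(2)[of f 0]) auto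
  then obtain b where b: "0 < b" "\<And>t. 0 < t \<Longrightarrow> t < b \<Longrightarrow> f t < \<epsilon> / 2"
    unfolding eventually_at_right_field by auto
  \<comment> \<open>\<open>d\<close> bounds the displacement of the family; the error is then at most \<open>d\<close> from the
    displacement and \<open>d + f d\<close> from \<open>\<phi>\<close>.\<close>
  define d where "d = min (b / 2) (\<epsilon> / 4)"
  have d: "0 < d" "d < b" "2 * d \<le> \<epsilon> / 2" using b(1) \<epsilon> by (auto simp: d_def min_def)
  have fd: "2 * d + f d < \<epsilon>" using b(2)[OF d(1,2)] d(3) by linarith
  from bpb_dual[unfolded functional_BPB_def, rule_format, OF d(1)]
  obtain \<eta>0 where "0 < \<eta>0" and bpb: "\<And>u x0. u \<in> dual s \<Longrightarrow> x0 \<in> sphere 0 1 \<Longrightarrow> norm u \<le> 1 \<Longrightarrow>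
      norm (blinfun_apply u x0) > 1 - \<eta>0 \<Longrightarrow>
      \<exists>v\<in>dual s. \<exists>x\<in>sphere 0 1. norm v = 1 \<and> norm (blinfun_apply v x) = 1 \<and>
        norm (x0 - x) < d \<and> norm (u - v) < d"
    by (elim exE conjE) (metis (no_types, lifting))
  \<comment> \<open>\<open>\<eta> \<le> 1\<close> guarantees \<open>T x0 \<noteq> 0\<close> at \<open>t0\<close>, so that \<open>T x0\<close> yields a bump there.\<close>
  define \<eta> where "\<eta> = min \<eta>0 1"
  have \<eta>: "0 < \<eta>" "\<eta> \<le> \<eta>0" "\<eta> \<le> 1" using \<open>0 < \<eta>0\<close> by (auto simp: \<eta>_def)
  have main: "\<exists>S\<in>operators s c0_scale. \<exists>x\<in>sphere 0 1. norm S = 1 \<and> norm (blinfun_apply S x) = 1 \<and>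
      norm (x0 - x) < \<epsilon> \<and> norm (T - S) < \<epsilon>"
    if T: "T \<in> operators s c0_scale" "norm T = 1" and x0: "x0 \<in> sphere 0 1"
      and near: "norm (T x0) > 1 - \<eta>" for T :: "'x \<Rightarrow>\<^sub>L ('a, 'k) c0" and x0
  proof -
    let ?U = "adjoint_eval T"
    have U: "?U t \<in> dual s" "norm (?U t) \<le> 1" for t
      using adjoint_eval_in_dual[OF T(1)] norm_adjoint_eval_le[of T t] T(2) by auto
    obtain t0 where t0: "norm (c0_apply (T x0) t0) > 1 - \<eta>"
      using near norm_c0_least[of "T x0" "1 - \<eta>"] by (meson not_le)
    obtain v x where v: "v \<in> dual s" "norm v = 1" and x: "norm x = 1" "norm (v x) = 1"
        "norm (x0 - x) < d" and Uv: "norm (?U t0 - v) < d"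
      using bpb[OF U(1) x0 U(2), of t0] t0 \<eta>(2) by auto
    have "c0_apply (T x0) t0 \<noteq> 0" using t0 \<eta>(3) by auto
    from c0_peak_function[OF this] obtain g and C where
        g: "continuous_on UNIV g" "g t0 = (1::real)" "\<And>t. 0 \<le> g t" "\<And>t. g t \<le> 1"
        "compact C" "\<And>t. t \<notin> C \<Longrightarrow> g t = 0"
      by blast
    define \<Psi> where "\<Psi> t = ?U t + g t *\<^sub>R (v - ?U t0)" for t
    have \<Psi>_dual: "\<Psi> t \<in> dual s" for t
      using U(1) v(1) by (auto simp: \<Psi>_def dual_def operators_def blinfun.add_left
          blinfun.scaleR_left blinfun.diff_left algebra_simps)
    have \<Psi>_cont: "continuous_map euclidean (weak_star s) \<Psi>"
      unfolding continuous_map_weak_star_iff using \<Psi>_dual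
      by (auto simp: \<Psi>_def blinfun.add_left blinfun.scaleR_left
          intro!: continuous_intros c0_continuous g(1))
    have \<Psi>_U: "norm (\<Psi> t - ?U t) \<le> d" for t
      using mult_mono[OF g(4)[of t] less_imp_le[OF Uv]] g(3)[of t]
      by (simp add: \<Psi>_def norm_minus_commute)
    have dist: "infdist (\<Psi> t) (dual_ball s) \<le> d" for t
      using infdist_le[of "?U t" "dual_ball s" "\<Psi> t"] U[of t] \<Psi>_U[of t]
      by (auto simp: dual_ball_def dist_norm)
    have \<phi>_ball: "\<phi> w \<in> dual s" "norm (\<phi> w) \<le> 1" if "w \<in> dual s" for w
      using \<phi> that unfolding approx_nearest_point_map_def dual_ball_def by auto
    have \<phi>_near: "norm (\<phi> w - w) \<le> infdist w (dual_ball s) + f (infdist w (dual_ball s))"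
      if "w \<in> dual s" for w
      using \<phi> that unfolding approx_nearest_point_map_def by blast
    have \<phi>_fix: "\<phi> w = w" if "w \<in> dual s" "norm w \<le> 1" for w
      using \<phi>_near[OF that(1)] that f by (simp add: dual_ball_def nearest_point_modulus_def)
    have \<phi>\<Psi>: "norm (\<phi> (\<Psi> t) - \<Psi> t) \<le> d + f d" for t
    proof -
      have "f (infdist (\<Psi> t) (dual_ball s)) \<le> f d"
        using f dist[of t] d(1) unfolding nearest_point_modulus_def
        by (intro mono_onD[of "{0..}" f]) (auto simp: infdist_nonneg)
      with \<phi>_near[OF \<Psi>_dual] dist show ?thesis by (meson add_mono order_trans)
    qed
    have cont: "continuous_map euclidean (weak_star s) (\<lambda>t. \<phi> (\<Psi> t))"
      using continuous_map_compose[OF \<Psi>_cont \<phi>_cont] by (simp add: o_def)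
    have "vanishes_at_infinity (\<lambda>t. \<phi> (\<Psi> t) y)" for y
    proof (rule vanishes_at_infinity_eq_off_compact[OF c0_vanishes[of "T y"] _ g(5)])
      show "continuous_on UNIV (\<lambda>t. \<phi> (\<Psi> t) y)"
        using cont by (simp add: continuous_map_weak_star_iff)
      show "\<phi> (\<Psi> t) y = c0_apply (T y) t" if "t \<notin> C" for t
        using \<phi>_fix[OF U] g(6)[OF that] by (simp add: \<Psi>_def)
    qed
    from operator_of_weak_star_family[OF cont _ this] \<phi>_ball(2)[OF \<Psi>_dual]
    obtain S where S: "S \<in> operators s c0_scale" "\<And>x t. c0_apply (blinfun_apply S x) t = \<phi> (\<Psi> t) x"
      by blast
    have "norm S \<le> 1"
      by (rule norm_c0_operator_le[OF _ _ S(2)]) (auto intro: \<phi>_ball \<Psi>_dual)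
    moreover have "\<phi> (\<Psi> t0) = v"
      using \<phi>_fix[OF v(1)] v(2) by (simp add: \<Psi>_def g(2))
    then have "1 \<le> norm (S x)"
      using norm_c0_upper[of "S x" t0] x(2) by (simp add: S(2))
    moreover have "norm (S x) \<le> norm S" using norm_blinfun[of S x] x(1) by simp
    ultimately have "norm S = 1" "norm (S x) = 1" by auto
    moreover have "norm (T - S) \<le> 2 * d + f d"
    proof (rule norm_c0_operator_le)
      show "0 \<le> 2 * d + f d" using f d(1) by (auto simp: nearest_point_modulus_def)
      show "norm (?U t - \<phi> (\<Psi> t)) \<le> 2 * d + f d" for t
        using norm_triangle_ineq[of "?U t - \<Psi> t" "\<Psi> t - \<phi> (\<Psi> t)"] \<phi>\<Psi>[of t] \<Psi>_U[of t]
        by (simp add: norm_minus_commute)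
      show "c0_apply ((T - S) y) t = (?U t - \<phi> (\<Psi> t)) y" for y t
        by (simp add: blinfun.diff_left S(2))
    qed
    ultimately show ?thesis
      using S(1) x fd d \<epsilon> by (intro bexI[of _ S] bexI[of _ x]) auto
  qed
  then show "\<exists>\<eta>>0. \<forall>T0\<in>operators s c0_scale. \<forall>x0\<in>sphere 0 1.
      norm T0 = 1 \<and> norm (blinfun_apply T0 x0) > 1 - \<eta> \<longrightarrow>
      (\<exists>S\<in>(operators s c0_scale :: ('x \<Rightarrow>\<^sub>L ('a, 'k) c0) set). \<exists>x\<in>sphere 0 1.
        norm S = 1 \<and> norm (blinfun_apply S x) = 1 \<and> norm (x0 - x) < \<epsilon> \<and> norm (T0 - S) < \<epsilon>)"
    using \<eta>(1) by blast
qed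

theorem theorem3p4:
  fixes sR :: "real \<Rightarrow> 'x::banach \<Rightarrow> 'x"
    and sC :: "complex \<Rightarrow> 'x \<Rightarrow> 'x"
  assumes "locally_compact_space (euclidean :: 'a::t2_space topology)"
  shows "(banach_over sR \<longrightarrow> admits_weak_star_approx_nearest_point_map sR \<longrightarrow>
            BPB_property sR (c0_scale :: real \<Rightarrow> ('a, real) c0 \<Rightarrow> ('a, real) c0)) \<and>
         (banach_over sC \<longrightarrow> admits_weak_star_approx_nearest_point_map sC \<longrightarrow>
            BPB_property sC (c0_scale :: complex \<Rightarrow> ('a, complex) c0 \<Rightarrow> ('a, complex) c0))"
  by (simp add: BPB_property_c0 functional_BPB_real functional_BPB_complex)

end
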